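(* For every $n\in\mathbb{N}$ the following relations hold in $U$: $$[y,xyy(xxyy)^n]_q=0,$$ $$[yxx(yyxx)^n,y]_q=(q-q^{-3})\left(yxx(yyxx)^ny-(yyxx)^{n+1}\right),$$ $$[x(yyxx)^n,y]_q=(q-q^{-3})x(yyxx)^ny,$$ $$[y,y(xxyy)^n]_q=(q^3-q^{-1})(yyxx)^nyy.$$
   Context: Let $\mathbb{F}$ be a field of characteristic zero and let $q\in\mathbb{F}$ be nonzero and not a root of unity; $\mathbb{N}=\{0,1,2,\ldots\}$. Let $\mathbb{V}$ be the free associative unital $\mathbb{F}$-algebra on two noncommuting generators (letters) $x,y$; the words in $x,y$ (including the trivial word $\mathbf{1}$) form a basis of $\mathbb{V}$. Words such as $(xxyy)^nx$ are written with respect to the free (concatenation) product. The $q$-shuffle product $\star$ on the vector space $\mathbb{V}$ is the bilinear associative product with unit $\mathbf{1}$ determined as follows. Put $\langle x,x\rangle=\langle y,y\rangle=2$ and $\langle x,y\rangle=\langle y,x\rangle=-2$. For nontrivial words $u=u_1\cdots u_r$ and $v=v_1\cdots v_s$, $$u\star v=u_1\big((u_2\cdots u_r)\star v\big)+v_1\big(u\star(v_2\cdots v_s)\big)q^{\langle v_1,u_1\rangle+\cdots+\langle v_1,u_r\rangle}.$$ $U$ denotes the subalgebra of $(\mathbb{V},\star)$ generated by $x,y$; all the words in the statement lie in $U$. The $q$-commutator is taken with respect to $\star$: $[X,Y]_q=qX\star Y-q^{-1}Y\star X$. *)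

theory Defs
  imports Complex_Main "HOL-Library.Poly_Mapping"
begin

section \<open>The free algebra on two letters\<close>

datatype letter = X | Y

text \<open>
  Words are lists of letters, made a monoid under concatenation. Finitely supported functions
  on a monoid carry the convolution product of \<^theory>\<open>HOL-Library.Poly_Mapping\<close>; hence
  the ring structure on \<open>'a free_alg\<close>, written \<open>+\<close>, \<open>*\<close> and \<open>^\<close>, is that of the free
  associative unital algebra, and \<open>*\<close> is the free (concatenation) product.
\<close>

instantiation list :: (type) monoid_add
begin

definition zero_list :: "'a list" where "zero_list = []"

definition plus_list :: "'a list \<Rightarrow> 'a list \<Rightarrow> 'a list" where "plus_list = append"

instance by standard (simp_all add: zero_list_def plus_list_def)

end

type_synonym 'a free_alg = "letter list \<Rightarrow>\<^sub>0 'a"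

definition word :: "letter list \<Rightarrow> 'a::field free_alg"
  where "word w = Poly_Mapping.single w 1"

abbreviation gen :: "letter \<Rightarrow> 'a::field free_alg"
  where "gen a \<equiv> word [a]"

definition scal :: "'a::field \<Rightarrow> 'a free_alg \<Rightarrow> 'a free_alg"
  where "scal c p = Poly_Mapping.map (\<lambda>t. c * t) p"

lemma lookup_scal: "Poly_Mapping.lookup (scal c p) w = c * Poly_Mapping.lookup p w"
  by (simp add: scal_def Poly_Mapping.map.rep_eq when_def)

lemma word_Nil: "word [] = 1"
  by (simp add: word_def zero_list_def[symmetric])

lemma word_append: "word (u @ v) = word u * word v"
  by (simp add: word_def mult_single plus_list_def)

section \<open>The q-shuffle product\<close>

definition pairing :: "letter \<Rightarrow> letter \<Rightarrow> int"
  where "pairing a b = (if a = b then 2 else - 2)"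

fun qshuffle_word :: "'a::field \<Rightarrow> letter list \<Rightarrow> letter list \<Rightarrow> 'a free_alg" where
  "qshuffle_word q [] v = word v"
| "qshuffle_word q (a # u) [] = word (a # u)"
| "qshuffle_word q (a # u) (b # v) =
     gen a * qshuffle_word q u (b # v)
     + scal (q powi (\<Sum>c\<leftarrow>a # u. pairing b c)) (gen b * qshuffle_word q (a # u) v)"

definition qshuffle :: "'a::field \<Rightarrow> 'a free_alg \<Rightarrow> 'a free_alg \<Rightarrow> 'a free_alg"
  where "qshuffle q p r =
    (\<Sum>u\<in>Poly_Mapping.keys p. \<Sum>v\<in>Poly_Mapping.keys r.
       scal (Poly_Mapping.lookup p u * Poly_Mapping.lookup r v) (qshuffle_word q u v))"

lemma qshuffle_word_word: "qshuffle q (word u) (word v) = qshuffle_word q u v"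
  by (rule poly_mapping_eqI) (simp add: qshuffle_def word_def lookup_scal)

text \<open>
  The subalgebra \<open>U\<close> generated by the two letters carries the restriction of \<^const>\<open>qshuffle\<close>,
  so identities between its elements are stated in the ambient space.
\<close>

definition qcomm :: "'a::field \<Rightarrow> 'a free_alg \<Rightarrow> 'a free_alg \<Rightarrow> 'a free_alg"
  where "qcomm q p r = scal q (qshuffle q p r) - scal (inverse q) (qshuffle q r p)"

end

theory Submission
  imports Defs
begin

text \<open>
  Multiplying a word by the letter \<open>y\<close> inserts \<open>y\<close> at every position, weighted by the letters to
  its left for \<open>y \<star> v\<close> and by those to its right for \<open>v \<star> y\<close>. Each of the four words, for
  \<open>n + 1\<close>, is the one for \<open>n\<close> preceded by a balanced block \<open>xyyx\<close> or \<open>yxxy\<close>. Peeling off this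
  block multiplies the q-commutator on the left by it, up to boundary terms: these cancel for
  \<open>xyyx\<close> and telescope for \<open>yxxy\<close>.
\<close>

lemma scal_add: "scal c (p + r) = scal c p + scal c r"
  by (rule poly_mapping_eqI) (simp add: lookup_scal lookup_add algebra_simps)

lemma scal_diff: "scal c (p - r) = scal c p - scal c r"
  by (rule poly_mapping_eqI) (simp add: lookup_scal lookup_minus algebra_simps)

lemma scal_scal: "scal c (scal d p) = scal (c * d) p"
  by (rule poly_mapping_eqI) (simp add: lookup_scal)

lemma scal_eq_mult: "scal c p = Poly_Mapping.single 0 c * p"
  by (simp add: scal_def mult_map_scale_conv_mult)

lemma word_mult_scal: "word w * scal c p = scal c (word w * p)"
proof -
  have "word w * Poly_Mapping.single 0 c = Poly_Mapping.single 0 c * word w"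
    by (simp add: word_def mult_single)
  then show ?thesis
    by (simp add: scal_eq_mult flip: mult.assoc)
qed

lemma gen_mult_word: "gen a * word v = word (a # v)"
  by (simp flip: word_append)

lemma mult_power_shift: "a * (b * a) ^ n = (a * b) ^ n * (a :: 'a::monoid_mult)"
  by (induction n) (simp_all add: mult.assoc)

text \<open>The exponent of \<open>q\<close> collected when the letter \<open>b\<close> passes the
  word \<open>v\<close>.\<close>

definition weight :: "letter \<Rightarrow> letter list \<Rightarrow> int"
  where "weight b v = (\<Sum>c\<leftarrow>v. pairing b c)"

lemma weight_Nil [simp]: "weight b [] = 0"
  and weight_Cons [simp]: "weight b (a # v) = pairing b a + weight b v"
  and weight_append [simp]: "weight b (u @ v) = weight b u + weight b v"
  by (simp_all add: weight_def)

lemma qshuffle_gen_word_Cons: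
  "qshuffle q (gen b) (word (a # v)) =
    word (b # a # v) + scal (q powi pairing a b) (gen a * qshuffle q (gen b) (word v))"
  by (simp add: qshuffle_word_word gen_mult_word)

lemma qshuffle_word_Cons_gen:
  "qshuffle q (word (a # u)) (gen b) =
    gen a * qshuffle q (word u) (gen b) + scal (q powi weight b (a # u)) (word (b # a # u))"
  by (simp add: qshuffle_word_word gen_mult_word weight_def)

lemma qshuffle_gen_Nil: "qshuffle q (gen b) (word []) = gen b"
  and qshuffle_Nil_gen: "qshuffle q (word []) (gen b) = gen b"
  by (simp_all add: qshuffle_word_word)

lemmas scal_simps = scal_add scal_diff scal_scal word_mult_scal distrib_left right_diff_distrib

lemmas insert_simps = qcomm_def qshuffle_gen_word_Cons qshuffle_word_Cons_gen gen_mult_word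
  qshuffle_gen_Nil qshuffle_Nil_gen

lemmas coeff_simps = lookup_scal lookup_add lookup_minus pairing_def power_int_minus
  field_simps power2_eq_square power3_eq_cube power4_eq_xxxx

text \<open>Exposes the block letter by letter, the nested shape that the insertion recursion
  produces.\<close>

lemma word_block_mult:
  "word [a, b, c, d] * p = gen a * (gen b * (gen c * (gen d * p)))"
  by (simp add: gen_mult_word flip: mult.assoc)

text \<open>A \<open>Y\<close> inserted after letters of weight \<open>l\<close> has coefficient
  \<open>q powi (1 + l) - q powi (1 - l)\<close>, because the whole word has weight 2. This is odd
  in \<open>l\<close>. In front of the block \<open>l = 0\<close>; around its two letters
  \<open>Y\<close> the values are -2, 0, 2, all for the same word, so they cancel. The block has
  weight 0, so insertions behind it have the coefficients they have in \<open>v\<close>.\<close>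

lemma qcomm_Y_XYYX:
  assumes "q \<noteq> 0" "weight Y v = 2"
  shows "qcomm q (gen Y) (word ([X, Y, Y, X] @ v)) =
    word [X, Y, Y, X] * qcomm q (gen Y) (word v)"
  unfolding word_block_mult
  by (rule poly_mapping_eqI) (use assms in \<open>simp add: insert_simps scal_simps coeff_simps\<close>)

text \<open>The same cancellation: total weight -2 gives the coefficient
  \<open>q powi (-1 - l) - q powi (-1 + l)\<close>, again odd in \<open>l\<close>.\<close>

lemma qcomm_XYYX_Y:
  assumes "q \<noteq> 0" "weight Y v = - 2"
  shows "qcomm q (word ([X, Y, Y, X] @ v)) (gen Y) =
    word [X, Y, Y, X] * qcomm q (word v) (gen Y)"
  unfolding word_block_mult
  by (rule poly_mapping_eqI) (use assms in \<open>simp add: insert_simps scal_simps coeff_simps\<close>)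

text \<open>Here \<open>l\<close> takes the values 0, 2, 0, -2 in front of the four letters. The
  values 2 and -2 now belong to different words, the two boundary terms.\<close>

lemma qcomm_Y_YXXY:
  assumes "q \<noteq> 0" "weight Y v = 2"
  shows "qcomm q (gen Y) (word ([Y, X, X, Y] @ v)) =
    word [Y, X, X, Y] * qcomm q (gen Y) (word v)
    + scal (q ^ 3 - inverse q) (word ([Y, Y, X, X, Y] @ v) - word ([Y, X, X, Y, Y] @ v))"
  unfolding word_block_mult
  by (rule poly_mapping_eqI) (use assms in \<open>simp add: insert_simps scal_simps coeff_simps\<close>)

lemma qcomm_YXXY_Y:
  assumes "q \<noteq> 0" "weight Y v = - 2"
  shows "qcomm q (word ([Y, X, X, Y] @ v)) (gen Y) =
    word [Y, X, X, Y] * qcomm q (word v) (gen Y)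
    + scal (q - q powi (-3)) (word ([Y, X, X, Y, Y] @ v) - word ([Y, Y, X, X, Y] @ v))"
  unfolding word_block_mult
  by (rule poly_mapping_eqI) (use assms in \<open>simp add: insert_simps scal_simps coeff_simps\<close>)

definition pow_word :: "letter list \<Rightarrow> nat \<Rightarrow> letter list"
  where "pow_word w n = concat (replicate n w)"

lemma pow_word_0 [simp]: "pow_word w 0 = []"
  and pow_word_Suc [simp]: "pow_word w (Suc n) = w @ pow_word w n"
  by (simp_all add: pow_word_def)

lemma word_pow_word: "word (pow_word w n) = word w ^ n"
  by (induction n) (simp_all add: word_Nil word_append)

lemma weight_pow_word [simp]: "weight b (pow_word w n) = int n * weight b w"
  by (induction n) (simp_all add: algebra_simps)

lemma qcomm_Y_XYY:
  assumes "q \<noteq> 0"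
  shows "qcomm q (gen Y) (word ([X, Y, Y] @ pow_word [X, X, Y, Y] n)) = 0"
proof (induction n)
  case 0
  show ?case
    by (rule poly_mapping_eqI) (use assms in \<open>simp add: insert_simps scal_simps coeff_simps\<close>)
next
  case (Suc n)
  have "weight Y ([X, Y, Y] @ pow_word [X, X, Y, Y] n) = 2"
    by (simp add: pairing_def)
  \<comment> \<open>The word for \<open>Suc n\<close> regroups as \<open>xyyx\<close> followed by
    \<open>xyy(xxyy)^n\<close>.\<close>
  from qcomm_Y_XYYX[OF assms this] show ?case
    by (simp add: Suc.IH[simplified])
qed

lemma qcomm_X_Y:
  assumes "q \<noteq> 0"
  shows "qcomm q (word ([X] @ pow_word [Y, Y, X, X] n)) (gen Y) =
    scal (q - q powi (-3)) (word ([X] @ pow_word [Y, Y, X, X] n @ [Y]))"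
proof (induction n)
  case 0
  show ?case
    by (rule poly_mapping_eqI) (use assms in \<open>simp add: insert_simps scal_simps coeff_simps\<close>)
next
  case (Suc n)
  have "weight Y ([X] @ pow_word [Y, Y, X, X] n) = - 2"
    by (simp add: pairing_def)
  from qcomm_XYYX_Y[OF assms this] show ?case
    by (simp add: Suc.IH[simplified] scal_simps flip: word_append)
qed

lemma qcomm_YXX_Y:
  assumes "q \<noteq> 0"
  shows "qcomm q (word ([Y, X, X] @ pow_word [Y, Y, X, X] n)) (gen Y) =
    scal (q - q powi (-3))
      (word ([Y, X, X] @ pow_word [Y, Y, X, X] n @ [Y]) - word (pow_word [Y, Y, X, X] (n + 1)))"
proof (induction n)
  case 0
  show ?case
    by (rule poly_mapping_eqI) (use assms in \<open>simp add: insert_simps scal_simps coeff_simps\<close>)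
next
  case (Suc n)
  have "weight Y ([Y, X, X] @ pow_word [Y, Y, X, X] n) = - 2"
    by (simp add: pairing_def)
  \<comment> \<open>The block times \<open>(yyxx)^(n+1)\<close> from the induction hypothesis
    cancels the boundary word starting with \<open>yxxyy\<close>; the other boundary word is
    \<open>(yyxx)^(n+2)\<close>.\<close>
  from qcomm_YXXY_Y[OF assms this] show ?case
    by (simp add: Suc.IH[simplified] scal_simps flip: word_append)
qed

lemma qcomm_Y_Y:
  assumes "q \<noteq> 0"
  shows "qcomm q (gen Y) (word ([Y] @ pow_word [X, X, Y, Y] n)) =
    scal (q ^ 3 - inverse q) (word ([Y, Y] @ pow_word [X, X, Y, Y] n))"
proof (induction n)
  case 0
  show ?case
    by (rule poly_mapping_eqI) (use assms in \<open>simp add: insert_simps scal_simps coeff_simps\<close>)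
next
  case (Suc n)
  have "weight Y ([Y] @ pow_word [X, X, Y, Y] n) = 2"
    by (simp add: pairing_def)
  \<comment> \<open>The induction hypothesis contributes \<open>yxxyyy(xxyy)^n\<close>, which
    cancels the negative boundary term.\<close>
  from qcomm_Y_YXXY[OF assms this] show ?case
    by (simp add: Suc.IH[simplified] scal_simps flip: word_append)
qed

theorem proposition4p4:
  fixes q :: "'a::field_char_0" and n :: nat and x y :: "'a free_alg"
  assumes q_nonzero: "q \<noteq> 0"
    and q_not_root_of_unity: "\<And>k::nat. k > 0 \<Longrightarrow> q ^ k \<noteq> 1"
  defines "x \<equiv> gen X" and "y \<equiv> gen Y"
  shows "qcomm q y (x * y * y * (x * x * y * y) ^ n) = 0
    \<and> qcomm q (y * x * x * (y * y * x * x) ^ n) y =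
        scal (q - q powi (-3))
          (y * x * x * (y * y * x * x) ^ n * y - (y * y * x * x) ^ (n + 1))
    \<and> qcomm q (x * (y * y * x * x) ^ n) y =
        scal (q - q powi (-3)) (x * (y * y * x * x) ^ n * y)
    \<and> qcomm q y (y * (x * x * y * y) ^ n) =
        scal (q ^ 3 - inverse q) ((y * y * x * x) ^ n * y * y)"
proof -
  have w: "word (pow_word [a, b, c, d] m) = (gen a * gen b * gen c * gen d) ^ m" for a b c d m
    by (simp add: word_pow_word flip: word_append)
  \<comment> \<open>The induction for the fourth relation keeps \<open>yy\<close> in front, whereas
    the theorem has it at the end.\<close>
  have shift: "(y * y * x * x) ^ n * y * y = y * y * (x * x * y * y) ^ n"
    using mult_power_shift[of "y * y" "x * x" n] by (simp add: mult.assoc)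
  show ?thesis
    unfolding shift
    using qcomm_Y_XYY[OF q_nonzero, of n] qcomm_YXX_Y[OF q_nonzero, of n]
      qcomm_X_Y[OF q_nonzero, of n] qcomm_Y_Y[OF q_nonzero, of n]
    unfolding x_def y_def w[symmetric] by (simp flip: word_append)
qed

end
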